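(* Let $n>1$ be an integer and consider $$f_{n,1}(x)=\sum_{j\geq 0}\binom{n-1}{2j+1}(x^j-x^{j+1})\in\mathbb{F}_2[x]$$ (coefficients reduced modulo $2$). Then $f_{n,1}(x)$ is self-reciprocal if and only if $n$ is even.
   Context: Binomial coefficients $\binom{a}{b}$ are $0$ when $b>a$. A nonzero polynomial $f(x)$ of (actual) degree $d\ge0$ is self-reciprocal if $x^d f(1/x)=f(x)$; the zero polynomial is not self-reciprocal. *)

theory Defs
  imports "HOL-Computational_Algebra.Polynomial" "HOL-Library.Z2"
begin

text \<open>The library polynomial \<open>reflect_poly f\<close> is \<open>x\<^sup>d f(1/x)\<close> with \<open>d = degree f\<close>:
  its \<open>i\<close>-th coefficient is \<open>coeff f (d - i)\<close> for \<open>i \<le> d\<close> and \<open>0\<close> otherwise.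
  The zero polynomial, which equals its own reflection, is excluded explicitly.\<close>

definition self_reciprocal :: "'a::zero poly \<Rightarrow> bool" where
  "self_reciprocal f \<longleftrightarrow> f \<noteq> 0 \<and> reflect_poly f = f"

text \<open>The field with two elements is \<open>bit\<close>. The sum over all \<open>j \<ge> 0\<close> is cut off at
  \<open>j = n\<close>: for \<open>j > n\<close> the binomial coefficient vanishes because \<open>2j + 1 > n - 1\<close>.\<close>

definition f_n1 :: "nat \<Rightarrow> bit poly" where
  "f_n1 n = (\<Sum>j\<le>n. smult (of_nat ((n - 1) choose (2 * j + 1))) (monom 1 j - monom 1 (j + 1)))"

end

theory Submission
  imports Defs
begin

text \<open>Modulo 2, \<open>(2k) choose (2j+1)\<close> vanishes and \<open>(2k+1) choose (2j+1)\<close> reduces to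
  \<open>k choose j\<close>. Hence the polynomial is \<open>0\<close> for odd \<open>n\<close>, whereas for \<open>n = 2k + 2\<close> it equals
  \<open>(1 - x) (1 + x)^k = (1 + x)^(k+1)\<close>, a power of a self-reciprocal polynomial.\<close>

text \<open>Coefficient form of \<open>(1 + x)^(2k) = (1 + x^2)^k\<close> modulo 2. Pascal's rule
  applied twice carries row \<open>2k\<close> to row \<open>2k + 2\<close>.\<close>

lemma of_nat_choose_double_bit:
  "(of_nat ((2 * k) choose (2 * j)) :: bit) = of_nat (k choose j)"
  "(of_nat ((2 * k) choose (2 * j + 1)) :: bit) = 0"
proof (induction k arbitrary: j)
  case 0
  {
    case 1
    show ?case by (cases j) auto
  next
    case 2
    show ?case by simp
  }
next
  case (Suc k)
  \<comment> \<open>The middle term of the double Pascal step occurs twice and cancels.\<close>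
  have double: "x + (x + y) = y" for x y :: bit
    by (cases x; cases y) auto
  {
    case 1
    show ?case
    proof (cases j)
      case j: (Suc i)
      then show ?thesis
        using Suc.IH(1)[of i] Suc.IH(1)[of j] Suc.IH(2)[of i]
        by (simp add: double add.assoc add.left_commute)
    qed simp
  next
    case 2
    show ?case
      using Suc.IH(2)[of j] Suc.IH(2)[of "j - 1"] Suc.IH(1)[of j]
      by (cases j) (simp_all add: double add.assoc add.left_commute)
  }
qed

lemma of_nat_choose_odd_bit:
  "(of_nat ((2 * k + 1) choose (2 * j + 1)) :: bit) = of_nat (k choose j)"
  using of_nat_choose_double_bit[of k j] by simp

lemma f_n1_odd: "f_n1 (2 * k + 1) = 0"
  using of_nat_choose_double_bit(2)[of k] by (simp add: f_n1_def)

text \<open>Binomial theorem with a free upper bound \<open>m\<close>, since the cutoff in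
  \<open>f_n1\<close> exceeds \<open>k\<close>; the extra terms are zero.\<close>

lemma sum_choose_monom:
  assumes "k \<le> m"
  shows "(\<Sum>j\<le>m. monom (of_nat (k choose j)) j) = ([:1, 1:] :: 'a::comm_semiring_1 poly) ^ k"
proof -
  have "([:1, 1:] :: 'a poly) ^ k = (monom 1 1 + 1) ^ k"
    by (simp add: monom_altdef one_pCons)
  also have "\<dots> = (\<Sum>j\<le>k. monom (of_nat (k choose j)) j)"
    by (simp add: binomial_ring monom_power of_nat_poly smult_monom)
  also have "\<dots> = (\<Sum>j\<le>m. monom (of_nat (k choose j)) j)"
    using assms by (intro sum.mono_neutral_left) (auto simp: binomial_eq_0)
  finally show ?thesis ..
qed

lemma f_n1_even: "f_n1 (2 * k + 2) = [:1, 1:] ^ (k + 1)"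
proof -
  have "f_n1 (2 * k + 2) =
      (\<Sum>j\<le>2 * k + 2. (1 - monom 1 1) * monom (of_nat (k choose j)) j)"
    unfolding f_n1_def
    using of_nat_choose_odd_bit[of k]
    \<comment> \<open>The factor \<open>1 - x\<close> comes out of \<open>x^j - x^(j+1)\<close>.
      Pascal's rule must not split the odd-row binomial here.\<close>
    by (intro sum.cong)
      (simp_all add: left_diff_distrib smult_diff_right smult_monom mult_monom
        del: binomial_Suc_Suc)
  also have "\<dots> = (1 - monom 1 1) * [:1, 1:] ^ k"
    unfolding sum_distrib_left[symmetric] by (subst sum_choose_monom) auto
  \<comment> \<open>In characteristic 2, \<open>-1 = 1\<close>, so this factor raises the exponent
    by one.\<close>
  also have "1 - monom 1 1 = [:1, 1 :: bit:]"
    by (simp add: monom_altdef one_pCons)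
  finally show ?thesis by simp
qed

theorem theorem4p1:
  fixes n :: nat
  assumes "n > 1"
  shows "self_reciprocal (f_n1 n) \<longleftrightarrow> even n"
proof (cases "even n")
  case True
  then obtain m where "n = 2 * m" ..
  with assms obtain k where k: "n = 2 * k + 2"
    by (cases m) auto
  have "reflect_poly [:1, 1 :: bit:] = [:1, 1:]"
    by (simp add: reflect_poly_def)
  then have "self_reciprocal ([:1, 1 :: bit:] ^ (k + 1))"
    \<comment> \<open>Over a field reflection commutes with powers, and a power of a nonzero
      polynomial is nonzero.\<close>
    unfolding self_reciprocal_def reflect_poly_power by (simp del: power_Suc)
  with True show ?thesis
    by (simp only: k f_n1_even)
next
  case False
  then obtain k where "n = 2 * k + 1"
    by (elim oddE)
  with False show ?thesis
    by (simp add: f_n1_odd[simplified] self_reciprocal_def)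
qed

end
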